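(* Let $f:(a,b)\to\mathbb{R}$ be a continuously differentiable uniformly convex function with modulus $\Phi\ge 0$. Let $x_1,\dots,x_n\in(a,b)$ and let $(a_1,\dots,a_n)$ be a nonnegative $n$-tuple with $A_n=\sum_{i=1}^n a_i>0$. Let $\overline{x}=\frac{1}{A_n}\sum_{i=1}^n a_ix_i$. Then $$0\le\left|\frac{1}{A_n}\sum_{i=1}^n a_i\left|f(x_i)-f(\overline{x})-\Phi(|\overline{x}-x_i|)\right|-\frac{1}{A_n}\sum_{i=1}^n a_i|f'(\overline{x})|\,|\overline{x}-x_i|\right|$$ $$\le\frac{1}{A_n}\sum_{i=1}^n a_if(x_i)-f(\overline{x})-\frac{1}{A_n}\sum_{i=1}^n a_i\Phi(|\overline{x}-x_i|).$$
   Context: A function $f$ on an interval with endpoints $a<b$ is uniformly convex with modulus $\Phi:[0,b-a]\to[0,\infty)$ if $tf(x)+(1-t)f(y)\ge f(tx+(1-t)y)+t(1-t)\Phi(|x-y|)$ for all $x,y$ in the interval and all $t\in[0,1]$. By standing convention the modulus $\Phi$ is increasing with $\Phi(0)=0$. *)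

theory Defs
  imports "HOL-Analysis.Analysis"
begin

(* Phi and f are total functions; only the values of Phi on {0..b - a} and of f on I matter.
   The second and third conjuncts say that I is one of (a,b), [a,b), (a,b], [a,b].
   "Increasing" is read in the non-strict sense. *)
definition uniformly_convex_on ::
    "real \<Rightarrow> real \<Rightarrow> real set \<Rightarrow> (real \<Rightarrow> real) \<Rightarrow> (real \<Rightarrow> real) \<Rightarrow> bool" where
  "uniformly_convex_on a b I f \<Phi> \<longleftrightarrow>
     a < b \<and> {a<..<b} \<subseteq> I \<and> I \<subseteq> {a..b} \<and>
     \<Phi> ` {0..b - a} \<subseteq> {0..} \<and> mono_on {0..b - a} \<Phi> \<and> \<Phi> 0 = 0 \<and>
     (\<forall>x\<in>I. \<forall>y\<in>I. \<forall>t\<in>{0..1}.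
        t * f x + (1 - t) * f y \<ge> f (t * x + (1 - t) * y) + t * (1 - t) * \<Phi> \<bar>x - y\<bar>)"

end

theory Submission
  imports Defs
begin

text \<open>
  Dividing the defining inequality by \<open>t\<close> and letting \<open>t\<close> tend to \<open>0\<close> sharpens the tangent line
  inequality to \<open>f x - f m - \<Phi> \<bar>x - m\<bar> - f' m * (x - m) \<ge> 0\<close>. Taking absolute values and applying
  the reverse triangle inequality bounds \<open>\<bar>\<bar>f x - f m - \<Phi> \<bar>x - m\<bar>\<bar> - \<bar>f' m\<bar> * \<bar>x - m\<bar>\<bar>\<close> by this
  quantity. When these bounds are averaged at the barycentre \<open>m\<close>, the linear terms cancel.
\<close>

lemma uniformly_convex_on_tangent:
  assumes uc: "uniformly_convex_on a b I f \<Phi>"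
    and D: "(f has_real_derivative D) (at m)"
    and m: "m \<in> I" and x: "x \<in> I"
  shows "f m + D * (x - m) + \<Phi> \<bar>x - m\<bar> \<le> f x"
proof -
  \<comment> \<open>\<open>?q t\<close> is what the defining inequality, with weight
    \<open>t\<close> on \<open>x\<close> and \<open>1 - t\<close> on \<open>m\<close>, leaves after
    subtracting \<open>f m\<close> and dividing by \<open>t\<close>. As the factor
    \<open>1 - t\<close> tends to 1, the whole modulus survives in the limit.\<close>
  let ?q = "\<lambda>t. (f (m + t * (x - m)) - f m) / t + (1 - t) * \<Phi> \<bar>x - m\<bar>"
  have "((\<lambda>t. f (m + t * (x - m))) has_real_derivative D * (x - m)) (at 0)"
    by (rule DERIV_chain2[where f = f]) (use D in \<open>auto intro!: derivative_eq_intros\<close>)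
  then have "((\<lambda>t. (f (m + t * (x - m)) - f m) / t) \<longlongrightarrow> D * (x - m)) (at 0)"
    by (simp add: has_field_derivative_iff)
  then have "(?q \<longlongrightarrow> D * (x - m) + (1 - 0) * \<Phi> \<bar>x - m\<bar>) (at_right 0)"
    by (intro tendsto_intros) (auto intro: filterlim_mono simp: at_le)
  \<comment> \<open>The limit is one-sided: cancelling \<open>t\<close> needs \<open>t > 0\<close>,
    and the convexity inequality needs \<open>t\<close> \<le> 1.\<close>
  moreover have "\<forall>\<^sub>F t in at_right 0. ?q t \<le> f x - f m"
    using eventually_at_right_real[of 0 1]
  proof (rule eventually_mono)
    fix t :: real
    assume t: "t \<in> {0<..<1}"
    with uc m x have "t * f x + (1 - t) * f m
        \<ge> f (t * x + (1 - t) * m) + t * (1 - t) * \<Phi> \<bar>x - m\<bar>"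
      by (auto simp: uniformly_convex_on_def)
    moreover have "t * x + (1 - t) * m = m + t * (x - m)"
      by (simp add: algebra_simps)
    moreover have "t * f x + (1 - t) * f m = f m + t * (f x - f m)"
      by (simp add: algebra_simps)
    moreover have "t * ?q t = f (m + t * (x - m)) - f m + t * (1 - t) * \<Phi> \<bar>x - m\<bar>"
      using t by (simp add: distrib_left)
    ultimately have "t * ?q t \<le> t * (f x - f m)"
      by (simp only:)
    with t show "?q t \<le> f x - f m"
      by (subst (asm) mult_le_cancel_left_pos) auto
  qed simp
  ultimately have "D * (x - m) + (1 - 0) * \<Phi> \<bar>x - m\<bar> \<le> f x - f m"
    by (rule tendsto_upperbound) simp
  then show ?thesis by simp
qed

theorem theorem7:
  fixes a b :: real and f \<Phi> :: "real \<Rightarrow> real"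
    and n :: nat and x w :: "nat \<Rightarrow> real" and A xbar :: real
  assumes C1: "f C1_differentiable_on {a<..<b}"
    and uc: "uniformly_convex_on a b {a<..<b} f \<Phi>"
    and x_in: "\<forall>i\<in>{1..n}. x i \<in> {a<..<b}"
    and w_nonneg: "\<forall>i\<in>{1..n}. 0 \<le> w i"
    and A_eq: "A = (\<Sum>i=1..n. w i)"
    and A_pos: "A > 0"
    and xbar_eq: "xbar = 1 / A * (\<Sum>i=1..n. w i * x i)"
  shows "0 \<le> \<bar>1 / A * (\<Sum>i=1..n. w i * \<bar>f (x i) - f xbar - \<Phi> \<bar>xbar - x i\<bar>\<bar>)
              - 1 / A * (\<Sum>i=1..n. w i * \<bar>deriv f xbar\<bar> * \<bar>xbar - x i\<bar>)\<bar>
       \<and> \<bar>1 / A * (\<Sum>i=1..n. w i * \<bar>f (x i) - f xbar - \<Phi> \<bar>xbar - x i\<bar>\<bar>)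
              - 1 / A * (\<Sum>i=1..n. w i * \<bar>deriv f xbar\<bar> * \<bar>xbar - x i\<bar>)\<bar>
         \<le> 1 / A * (\<Sum>i=1..n. w i * f (x i)) - f xbar
              - 1 / A * (\<Sum>i=1..n. w i * \<Phi> \<bar>xbar - x i\<bar>)"
proof -
  let ?I = "{1..n}"
  let ?m = xbar
  let ?d = "deriv f ?m"
  let ?g = "\<lambda>i. f (x i) - f ?m - \<Phi> \<bar>?m - x i\<bar>"
  have wx: "(\<Sum>i\<in>?I. w i * x i) = A * ?m"
    using xbar_eq A_pos by simp
  \<comment> \<open>The weights \<open>w i / A\<close> sum to 1, so the barycentre is a convex
    combination of points of the interval. Hence \<open>f\<close> is differentiable there and the
    tangent inequality applies.\<close>
  have "(\<Sum>i\<in>?I. (w i / A) *\<^sub>R x i) \<in> {a<..<b}"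
    using x_in w_nonneg A_pos
    by (intro convex_sum) (auto simp: A_eq simp flip: sum_divide_distrib)
  then have m: "?m \<in> {a<..<b}"
    by (simp add: xbar_eq sum_divide_distrib)
  with C1 have D: "(f has_real_derivative ?d) (at ?m)"
    by (auto simp: C1_differentiable_on_eq DERIV_deriv_iff_real_differentiable)
  have tangent: "\<bar>\<bar>?g i\<bar> - \<bar>?d\<bar> * \<bar>?m - x i\<bar>\<bar> \<le> ?g i - ?d * (x i - ?m)" if "i \<in> ?I" for i
  proof -
    have "0 \<le> ?g i - ?d * (x i - ?m)"
      using uniformly_convex_on_tangent[OF uc D m, of "x i"] x_in that
      by (simp add: abs_minus_commute)
    then show ?thesis
      \<comment> \<open>The difference of the two arguments is nonnegative by the previous fact, so
        its absolute value is the difference itself.\<close>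
      using abs_triangle_ineq3[of "?g i" "?d * (x i - ?m)"]
      by (simp add: abs_mult abs_minus_commute)
  qed
  have "\<bar>\<Sum>i\<in>?I. w i * (\<bar>?g i\<bar> - \<bar>?d\<bar> * \<bar>?m - x i\<bar>)\<bar>
      \<le> (\<Sum>i\<in>?I. w i * (?g i - ?d * (x i - ?m)))"
    by (rule sum_abs[THEN order_trans], rule sum_mono)
      (use tangent w_nonneg in \<open>auto simp: abs_mult intro!: mult_left_mono\<close>)
  also have "\<dots> = (\<Sum>i\<in>?I. w i * f (x i)) - (\<Sum>i\<in>?I. w i) * f ?m
      - (\<Sum>i\<in>?I. w i * \<Phi> \<bar>?m - x i\<bar>) - ?d * ((\<Sum>i\<in>?I. w i * x i) - (\<Sum>i\<in>?I. w i) * ?m)"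
    by (simp add: algebra_simps sum.distrib sum_subtractf sum_distrib_left sum_distrib_right)
  \<comment> \<open>By \<open>wx\<close>, the factor multiplying \<open>?d\<close> is
    \<open>A * ?m - A * ?m\<close>.\<close>
  also have "\<dots> = (\<Sum>i\<in>?I. w i * f (x i)) - A * f ?m - (\<Sum>i\<in>?I. w i * \<Phi> \<bar>?m - x i\<bar>)"
    by (simp only: wx A_eq[symmetric]) simp
  finally have "\<bar>\<Sum>i\<in>?I. w i * (\<bar>?g i\<bar> - \<bar>?d\<bar> * \<bar>?m - x i\<bar>)\<bar> / A
      \<le> ((\<Sum>i\<in>?I. w i * f (x i)) - A * f ?m - (\<Sum>i\<in>?I. w i * \<Phi> \<bar>?m - x i\<bar>)) / A"
    using A_pos by (intro divide_right_mono) auto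
  \<comment> \<open>Since \<open>A > 0\<close>, division by \<open>A\<close> passes through the
    absolute value, and the single sum splits into the two averages of the claim.\<close>
  moreover have "\<bar>\<Sum>i\<in>?I. w i * (\<bar>?g i\<bar> - \<bar>?d\<bar> * \<bar>?m - x i\<bar>)\<bar> / A
      = \<bar>1 / A * (\<Sum>i\<in>?I. w i * \<bar>?g i\<bar>) - 1 / A * (\<Sum>i\<in>?I. w i * \<bar>?d\<bar> * \<bar>?m - x i\<bar>)\<bar>"
  proof -
    have "1 / A * (\<Sum>i\<in>?I. w i * \<bar>?g i\<bar>) - 1 / A * (\<Sum>i\<in>?I. w i * \<bar>?d\<bar> * \<bar>?m - x i\<bar>)
        = (\<Sum>i\<in>?I. w i * (\<bar>?g i\<bar> - \<bar>?d\<bar> * \<bar>?m - x i\<bar>)) / A"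
      by (simp add: right_diff_distrib sum_subtractf diff_divide_distrib mult.assoc)
    then show ?thesis
      using A_pos by simp
  qed
  ultimately show ?thesis
    using A_pos by (simp add: diff_divide_distrib)
qed

end
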